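(* Suppose $4\mid n$. If $\phi$ is an $\{n/2,n\}$-isometry of $\mathcal{C}_n$ fixing the set $\{\overline{0},\overline{1}\}$, then there are two permutations $\pi_1,\pi_2$ of $\{1,\ldots,n\}$, two subsets $S_1,S_2$ of $E_X$, and two odd weight words $\overline{a},\overline{b}$ such that $$\phi(\overline{c})=\begin{cases} \pi_1(\overline{c}) & \text{if } \overline{c}\in E \text{ and } \{\overline{c},\overline{1}+\overline{c}\}\cap S_1=\emptyset,\\ \pi_1(\overline{c})+\overline{1} & \text{if } \overline{c}\in E \text{ and } \{\overline{c},\overline{1}+\overline{c}\}\cap S_1\neq\emptyset,\\ \overline{b}+\pi_2(\overline{c}+\overline{a}) & \text{if } \overline{c}\in O \text{ and } \{\overline{c}+\overline{a},\overline{1}+\overline{c}+\overline{a}\}\cap S_2=\emptyset,\\ \overline{b}+\pi_2(\overline{c}+\overline{a})+\overline{1} & \text{if } \overline{c}\in O \text{ and } \{\overline{c}+\overline{a},\overline{1}+\overline{c}+\overline{a}\}\cap S_2\neq\emptyset.\end{cases}$$ Conversely, for any two permutations $\pi_1,\pi_2$ of $\{1,\ldots,n\}$, any $S_1,S_2\subset E_X$, and any two odd weight words $\overline{a},\overline{b}$, this formula defines an $\{n/2,n\}$-isometry fixing the set $\{\overline{0},\overline{1}\}$.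
   Context: $\mathcal{C}_n=\{0,1\}^n$ is the Boolean cube with Hamming distance $d$ and component-wise addition modulo $2$; $\overline{0}=(0,\ldots,0)$, $\overline{1}=(1,\ldots,1)$. The weight of a word is its number of non-zero positions; $E$ and $O$ are the sets of words of even and odd weight, respectively. For $n$ even, $X=X_1\cup X_2$, where $X_1$ is the set of all words of weight less than $n/2$ and $X_2$ is the set of all words of weight $n/2$ whose first coordinate is $0$; $E_X$ is the set of words of even weight in $X$. A permutation $\pi$ of $\{1,\ldots,n\}$ is identified with the map $\pi(x_1,\ldots,x_n)=(x_{\pi(1)},\ldots,x_{\pi(n)})$ on $\mathcal{C}_n$. An $\{n/2,n\}$-isometry is a bijection $\phi$ of $\mathcal{C}_n$ such that, for each $p\in\{n/2,n\}$, $d(\phi(x),\phi(y))=p$ whenever $d(x,y)=p$. Fixing the set $\{\overline{0},\overline{1}\}$ means mapping it onto itself (setwise). *)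

theory Defs
  imports
    Main
    "HOL-Library.Z2"
    "HOL-Library.Function_Algebras"
    "HOL-Combinatorics.Permutations"
begin

type_synonym word = "nat \<Rightarrow> bit"

text \<open>
  Words of length \<open>n\<close> are functions on \<open>nat\<close> vanishing outside the coordinates \<open>1, \<dots>, n\<close>.
  Thus the component-wise sum of words is the pointwise sum \<open>x + y\<close> of functions, and the
  zero word is \<open>0\<close>. The all-one word is \<open>ones n\<close>, not the constant function \<open>1\<close>, which is
  not in the cube.
\<close>

definition cube :: "nat \<Rightarrow> word set" where
  "cube n = {x. \<forall>i. i \<notin> {1..n} \<longrightarrow> x i = 0}"

definition ones :: "nat \<Rightarrow> word" where
  "ones n = (\<lambda>i. if i \<in> {1..n} then 1 else 0)"

definition weight :: "word \<Rightarrow> nat" where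
  "weight x = card {i. x i \<noteq> 0}"

definition hamming_dist :: "word \<Rightarrow> word \<Rightarrow> nat" where
  "hamming_dist x y = card {i. x i \<noteq> y i}"

definition even_words :: "nat \<Rightarrow> word set" where
  "even_words n = {x \<in> cube n. even (weight x)}"

definition odd_words :: "nat \<Rightarrow> word set" where
  "odd_words n = {x \<in> cube n. odd (weight x)}"

text \<open>For even \<open>n\<close>, this contains exactly one word of each pair \<open>{x, ones n + x}\<close>.\<close>

definition X_words :: "nat \<Rightarrow> word set" where
  "X_words n = {x \<in> cube n. weight x < n div 2} \<union> {x \<in> cube n. weight x = n div 2 \<and> x 1 = 0}"

definition even_X_words :: "nat \<Rightarrow> word set" where
  "even_X_words n = X_words n \<inter> even_words n"

text \<open>A permutation fixes every index outside \<open>{1..n}\<close>, so \<open>x \<circ> \<pi>\<close> is again in the cube.\<close>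

definition perm_word :: "(nat \<Rightarrow> nat) \<Rightarrow> word \<Rightarrow> word" where
  "perm_word \<pi> x = x \<circ> \<pi>"

definition cube_isometry :: "nat \<Rightarrow> nat set \<Rightarrow> (word \<Rightarrow> word) \<Rightarrow> bool" where
  "cube_isometry n P \<phi> \<longleftrightarrow> bij_betw \<phi> (cube n) (cube n) \<and>
    (\<forall>p\<in>P. \<forall>x\<in>cube n. \<forall>y\<in>cube n.
      hamming_dist x y = p \<longrightarrow> hamming_dist (\<phi> x) (\<phi> y) = p)"

text \<open>Only used on \<open>cube n\<close>, where the outer \<open>else\<close> branch covers precisely the odd words.\<close>

definition formula_map ::
  "nat \<Rightarrow> (nat \<Rightarrow> nat) \<Rightarrow> (nat \<Rightarrow> nat) \<Rightarrow> word set \<Rightarrow> word set \<Rightarrow> word \<Rightarrow> word \<Rightarrow> word \<Rightarrow> word"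
where
  "formula_map n \<pi>\<^sub>1 \<pi>\<^sub>2 S\<^sub>1 S\<^sub>2 a b c =
    (if c \<in> even_words n then
       (if {c, ones n + c} \<inter> S\<^sub>1 = {} then perm_word \<pi>\<^sub>1 c
        else perm_word \<pi>\<^sub>1 c + ones n)
     else
       (if {c + a, ones n + c + a} \<inter> S\<^sub>2 = {} then b + perm_word \<pi>\<^sub>2 (c + a)
        else b + perm_word \<pi>\<^sub>2 (c + a) + ones n))"

end

theory Submission
  imports Defs "HOL-Library.Indicator_Function"
begin

text \<open>
  Complementing one of two words turns their distance \<open>d\<close> into \<open>n - d\<close>, so it respects the
  relation ``at distance \<open>n/2\<close>''. The theorem says that, on the words of even weight, nothing but
  coordinate permutations and independent complementations of antipodal pairs respects it; on
  the words of odd weight the same holds after a translation, because the distance \<open>n/2\<close> is even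
  and does not link the two classes.

  The distance \<open>n/2\<close> alone determines all even distances up to \<open>d \<mapsto> n - d\<close>. Two words at
  distance \<open>2k\<close> have \<open>binomial(2k, k) * binomial(n - 2k, n/2 - k)\<close> common neighbours at distance
  \<open>n/2\<close>, and two words at odd distance have none (lemma \<open>card_common_neighbours\<close>). An
  \<open>{n/2, n}\<close>-isometry preserves this number. Central binomial coefficients are strictly
  log-convex, so the product strictly decreases for \<open>2k \<le> n/2\<close>, and it is symmetric under
  \<open>2k \<mapsto> n - 2k\<close>. Hence an isometry preserves the parity of distances and maps an
  even distance \<open>d\<close> to \<open>d\<close> or \<open>n - d\<close> (lemma \<open>isometry_folded_distance\<close>).

  Let \<open>f\<close> be a map on the even words that preserves distances in this folded sense and fixes
  the zero word up to complement. The words with support \<open>{1, j}\<close> have weight \<open>2\<close> and pairwise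
  distance \<open>2\<close>. For \<open>n \<ge> 8\<close> their images are, up to complement, pairwise intersecting pairs, and
  there are at least seven of them, so they share a point \<open>v\<close>. For \<open>n = 4\<close> the complement of a
  pair is a pair, and complements can be chosen so that \<open>v = 1\<close>. Thus \<open>{1, j}\<close> goes to
  \<open>{v, h j}\<close> up to complement (lemma \<open>star_representatives\<close>), and \<open>h\<close> together with \<open>1 \<mapsto> v\<close>
  is a permutation.

  This permutation determines \<open>f\<close> up to complements: \<open>x\<close> separates \<open>1\<close> and \<open>j\<close> if and only if
  the distance from \<open>x\<close> to \<open>{1, j}\<close> equals the weight of \<open>x\<close>, and otherwise the two numbers
  differ by \<open>2\<close>. Since \<open>4\<close> divides \<open>n\<close>, folding does not blur this difference, so \<open>x\<close> separates
  \<open>1\<close> and \<open>j\<close> if and only if \<open>f x\<close> separates \<open>v\<close> and \<open>h j\<close>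
  (lemma \<open>separation_from_folded_distance\<close>). Knowing this for every \<open>j\<close> means knowing \<open>f x\<close> up
  to complement.

  The distance \<open>n\<close> makes the choice of complement the same on both words of an antipodal pair, so it
  can be recorded by a set of representatives of the pairs. The odd words reduce to the even
  ones by considering \<open>x \<mapsto> \<phi> a + \<phi> (x + a)\<close> for an odd word \<open>a\<close>. Conversely,
  a permutation followed by such a choice of complements respects the distances \<open>n/2\<close> and \<open>n\<close>.
\<close>

section \<open>Words as finite sets\<close>

definition supp :: "word \<Rightarrow> nat set" where
  "supp x = {i. x i = 1}"

abbreviation char_word :: "nat set \<Rightarrow> word" where
  "char_word A \<equiv> indicator A"

lemma word_add_self [simp]: "x + x = (0 :: word)"
  by (simp add: fun_eq_iff)

lemma word_add_add_self [simp]: "x + (x + y) = (y :: word)"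
  by (simp flip: add.assoc)

lemma word_add_eq_0_iff: "x + y = 0 \<longleftrightarrow> x = (y :: word)"
  by (metis add_0_right word_add_add_self word_add_self)

lemma weight_eq_card_supp: "weight x = card (supp x)"
  by (simp add: weight_def supp_def)

lemma hamming_dist_eq_weight: "hamming_dist x y = weight (x + y)"
proof -
  have "x i \<noteq> y i \<longleftrightarrow> (x + y) i \<noteq> 0" for i
    by (cases "x i"; cases "y i") auto
  then show ?thesis
    by (simp add: hamming_dist_def weight_def)
qed

lemma supp_add: "supp (x + y) = (supp x - supp y) \<union> (supp y - supp x)"
proof -
  have "i \<in> supp (x + y) \<longleftrightarrow> i \<in> (supp x - supp y) \<union> (supp y - supp x)" for i
    by (cases "x i"; cases "y i") (auto simp: supp_def)
  then show ?thesis by blast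
qed

lemma supp_char_word [simp]: "supp (char_word A) = A"
  by (auto simp: supp_def indicator_def)

lemma char_word_supp [simp]: "char_word (supp x) = x"
  by (auto simp: supp_def indicator_def fun_eq_iff)

lemma supp_eq_iff: "supp x = supp y \<longleftrightarrow> x = y"
  by (metis char_word_supp)

lemma mem_cube_iff: "x \<in> cube n \<longleftrightarrow> supp x \<subseteq> {1..n}"
proof -
  have "(\<forall>i. i \<notin> {1..n} \<longrightarrow> x i = 0) \<longleftrightarrow> (\<forall>i. x i = 1 \<longrightarrow> i \<in> {1..n})"
    by (metis bit_not_one_iff)
  then show ?thesis
    by (auto simp: cube_def supp_def)
qed

lemma finite_supp: "x \<in> cube n \<Longrightarrow> finite (supp x)"
  by (auto simp: mem_cube_iff intro: finite_subset)

lemma finite_cube: "finite (cube n)"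
proof (rule finite_imageD)
  show "finite (supp ` cube n)"
    by (rule finite_subset[of _ "Pow {1..n}"]) (force simp: mem_cube_iff)+
  show "inj_on supp (cube n)"
    by (auto simp: inj_on_def supp_eq_iff)
qed

lemma ones_eq_char_word: "ones n = char_word {1..n}"
  by (auto simp: ones_def indicator_def)

lemma ones_in_cube [simp]: "ones n \<in> cube n"
  by (simp add: mem_cube_iff ones_eq_char_word)

lemma zero_in_cube [simp]: "0 \<in> cube n"
  by (simp add: cube_def)

lemma add_in_cube [intro, simp]: "x \<in> cube n \<Longrightarrow> y \<in> cube n \<Longrightarrow> x + y \<in> cube n"
  by (auto simp: cube_def)

lemma weight_zero [simp]: "weight 0 = 0"
  by (simp add: weight_def)

lemma weight_ones [simp]: "weight (ones n) = n"
  by (simp add: weight_eq_card_supp ones_eq_char_word)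

lemma weight_le: "x \<in> cube n \<Longrightarrow> weight x \<le> n"
  using card_mono[of "{1..n}" "supp x"] by (simp add: weight_eq_card_supp mem_cube_iff)

lemma weight_eq_0_iff: "x \<in> cube n \<Longrightarrow> weight x = 0 \<longleftrightarrow> x = 0"
  using finite_supp[of x n] supp_eq_iff[of x 0] by (auto simp: weight_eq_card_supp supp_def)

lemma weight_add:
  assumes "x \<in> cube n" "y \<in> cube n"
  shows "weight (x + y) + 2 * card (supp x \<inter> supp y) = weight x + weight y"
proof -
  have fin: "finite (supp x)" "finite (supp y)"
    using assms finite_supp by auto
  have "weight (x + y) = card (supp x - supp y) + card (supp y - supp x)"
    unfolding weight_eq_card_supp supp_add using fin by (intro card_Un_disjoint) auto
  moreover have "card (supp x) = card (supp x - supp y) + card (supp x \<inter> supp y)"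
    using fin by (metis card_Diff_subset_Int card_mono finite_Int inf_le1 le_add_diff_inverse2)
  moreover have "card (supp y) = card (supp y - supp x) + card (supp x \<inter> supp y)"
    using fin by (metis card_Diff_subset_Int card_mono finite_Int inf_le2 le_add_diff_inverse2 inf_commute)
  ultimately show ?thesis
    by (simp add: weight_eq_card_supp)
qed

lemma even_weight_add:
  assumes "x \<in> cube n" "y \<in> cube n"
  shows "even (weight (x + y)) \<longleftrightarrow> (even (weight x) \<longleftrightarrow> even (weight y))"
proof -
  have "even (weight (x + y) + 2 * card (supp x \<inter> supp y)) \<longleftrightarrow> even (weight x + weight y)"
    unfolding weight_add[OF assms] ..
  then show ?thesis by simp
qed

lemma weight_add_ones:
  assumes "x \<in> cube n"
  shows "weight (x + ones n) = n - weight x"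
proof -
  have "supp x \<inter> supp (ones n) = supp x"
    using assms by (auto simp: mem_cube_iff ones_eq_char_word)
  then show ?thesis
    using weight_add[OF assms ones_in_cube] by (simp add: weight_eq_card_supp ones_eq_char_word)
qed

lemma weight_eq_n_iff:
  assumes "x \<in> cube n"
  shows "weight x = n \<longleftrightarrow> x = ones n"
  using weight_eq_0_iff[of "x + ones n" n] weight_add_ones[OF assms] assms weight_le[OF assms]
  by (auto simp: word_add_eq_0_iff)

section \<open>Counting common neighbours\<close>

text \<open>
  If \<open>z\<close> has weight \<open>N\<close>, then so has \<open>z + u\<close> exactly when \<open>z\<close> contains half of the support of
  \<open>u\<close>; such \<open>z\<close> are given by independent choices inside and outside the support of \<open>u\<close>. The bound
  on the weight of \<open>u\<close> keeps the natural subtraction \<open>N - weight u div 2\<close> from truncating.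
\<close>

lemma card_halving_words:
  assumes u: "u \<in> cube n" "weight u \<le> 2 * N"
  shows "card {z \<in> cube n. weight z = N \<and> weight (z + u) = N} =
    (if even (weight u)
     then (weight u choose (weight u div 2)) * ((n - weight u) choose (N - weight u div 2))
     else 0)"
proof -
  let ?U = "supp u" and ?k = "weight u div 2"
  have U: "?U \<subseteq> {1..n}" "finite ?U"
    using u(1) finite_supp by (auto simp: mem_cube_iff)
  have iff: "weight (z + u) = N \<longleftrightarrow> 2 * card (supp z \<inter> ?U) = weight u"
    if "z \<in> cube n" "weight z = N" for z
    using weight_add[OF that(1) u(1)] that(2) by auto
  show ?thesis
  proof (cases "even (weight u)")
    case False
    then have empty: "{z \<in> cube n. weight z = N \<and> weight (z + u) = N} = {}"
      using iff by (metis (mono_tags, lifting) dvd_triv_left empty_Collect_eq)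
    show ?thesis
      unfolding empty using False by simp
  next
    case True
    let ?Z = "{z \<in> cube n. weight z = N \<and> weight (z + u) = N}"
    let ?A = "{A. A \<subseteq> ?U \<and> card A = ?k}" and ?B = "{B. B \<subseteq> {1..n} - ?U \<and> card B = N - ?k}"
    have split: "card (supp z) = card (supp z \<inter> ?U) + card (supp z - ?U)" if "z \<in> cube n" for z
      using finite_supp[OF that]
      by (metis card_Diff_subset_Int card_mono finite_Int inf_le1 le_add_diff_inverse)
    have "bij_betw (\<lambda>z. (supp z \<inter> ?U, supp z - ?U)) ?Z (?A \<times> ?B)"
    proof (rule bij_betw_byWitness[where f' = "\<lambda>(A, B). char_word (A \<union> B)"])
      show "\<forall>z\<in>?Z. (\<lambda>(A, B). char_word (A \<union> B)) (supp z \<inter> ?U, supp z - ?U) = z"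
        by (auto simp: Int_Diff_Un)
      show "\<forall>P\<in>?A \<times> ?B. (\<lambda>z. (supp z \<inter> ?U, supp z - ?U)) ((\<lambda>(A, B). char_word (A \<union> B)) P) = P"
        by auto
      show "(\<lambda>z. (supp z \<inter> ?U, supp z - ?U)) ` ?Z \<subseteq> ?A \<times> ?B"
        using iff split by (auto simp: mem_cube_iff weight_eq_card_supp)
      show "(\<lambda>(A, B). char_word (A \<union> B)) ` (?A \<times> ?B) \<subseteq> ?Z"
      proof clarify
        fix A B assume A: "A \<subseteq> ?U" "card A = ?k" and B: "B \<subseteq> {1..n} - ?U" "card B = N - ?k"
        have z: "char_word (A \<union> B) \<in> cube n"
          using A B U by (auto simp: mem_cube_iff)
        have "finite A" "finite B" "A \<inter> B = {}" "(A \<union> B) \<inter> ?U = A"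
          using A B U by (auto intro: finite_subset)
        with A B u(2) have w: "weight (char_word (A \<union> B)) = N"
          by (simp add: weight_eq_card_supp card_Un_disjoint)
        have "weight (char_word (A \<union> B) + u) = N"
          unfolding iff[OF z w] using \<open>(A \<union> B) \<inter> ?U = A\<close> A(2) True by simp
        with z w show "char_word (A \<union> B) \<in> cube n \<and> weight (char_word (A \<union> B)) = N
            \<and> weight (char_word (A \<union> B) + u) = N" by simp
      qed
    qed
    then have "card ?Z = card ?A * card ?B"
      by (simp add: bij_betw_same_card card_cartesian_product)
    also have "card ?A = weight u choose ?k"
      using n_subsets[OF U(2)] by (simp add: weight_eq_card_supp)
    also have "card ?B = (n - weight u) choose (N - ?k)"
      using n_subsets[of "{1..n} - ?U" "N - ?k"] U by (simp add: weight_eq_card_supp card_Diff_subset)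
    finally show ?thesis
      using True by (simp only: if_True)
  qed
qed

lemma central_binomial_Suc:
  "Suc k * (2 * Suc k choose Suc k) = 2 * (2 * k + 1) * (2 * k choose k)"
proof -
  have "Suc k * (2 * Suc k choose Suc k) = (2 * k + 2) * (2 * k + 1 choose k)"
    using Suc_times_binomial[of k "2 * k + 1"] by simp
  also have "(2 * k + 1 choose k) = (2 * k + 1 choose Suc k)"
    using binomial_symmetric[of k "2 * k + 1"] by simp
  also have "(2 * k + 2) * \<dots> = 2 * (Suc k * (Suc (2 * k) choose Suc k))"
    by simp
  also have "\<dots> = 2 * (2 * k + 1) * (2 * k choose k)"
    unfolding Suc_times_binomial by simp
  finally show ?thesis .
qed


text \<open>
  The recurrence gives \<open>4 - 2 / (k + 1)\<close> for the ratio of consecutive central binomial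
  coefficients, which increases with \<open>k\<close>.
\<close>

lemma central_binomial_log_convex:
  assumes "k < l"
  shows "(2 * Suc k choose Suc k) * (2 * l choose l) < (2 * k choose k) * (2 * Suc l choose Suc l)"
proof -
  let ?a = "2 * k choose k" and ?b = "2 * l choose l"
  have pos: "0 < ?a * ?b" by simp
  have "Suc k * Suc l * ((2 * Suc k choose Suc k) * ?b) = (Suc k * (2 * Suc k choose Suc k)) * (Suc l * ?b)"
    by (simp only: ac_simps)
  also have "\<dots> = (2 * (2 * k + 1) * Suc l) * (?a * ?b)"
    unfolding central_binomial_Suc by (simp only: ac_simps)
  also have "\<dots> < (2 * (2 * l + 1) * Suc k) * (?a * ?b)"
    using assms pos by (intro mult_strict_right_mono) auto
  also have "\<dots> = (Suc l * (2 * Suc l choose Suc l)) * (Suc k * ?a)"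
    unfolding central_binomial_Suc by (simp only: ac_simps)
  also have "\<dots> = Suc k * Suc l * (?a * (2 * Suc l choose Suc l))"
    by (simp only: ac_simps)
  finally show ?thesis
    by (simp only: mult_less_cancel1)
qed

lemma central_binomial_product_strict_decreasing:
  assumes "i < j" "2 * j \<le> N"
  shows "(2 * j choose j) * (2 * (N - j) choose (N - j)) < (2 * i choose i) * (2 * (N - i) choose (N - i))"
  using assms
proof (induction j rule: less_induct)
  case (less j)
  then obtain k where j: "j = Suc k" and "i \<le> k"
    by (cases j) auto
  have "k < N - Suc k" and N: "N - k = Suc (N - Suc k)"
    using less.prems j by auto
  from central_binomial_log_convex[OF this(1)]
  have step: "(2 * j choose j) * (2 * (N - j) choose (N - j)) < (2 * k choose k) * (2 * (N - k) choose (N - k))"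
    unfolding j N .
  show ?case
  proof (cases "i = k")
    case True
    with step show ?thesis by simp
  next
    case False
    with \<open>i \<le> k\<close> less.prems j show ?thesis
      using less.IH[of k] step by auto
  qed
qed

lemma central_binomial_product_inj:
  assumes "i \<le> N" "j \<le> N"
    and "(2 * i choose i) * (2 * (N - i) choose (N - i)) = (2 * j choose j) * (2 * (N - j) choose (N - j))"
  shows "j = i \<or> j = N - i"
proof -
  (* Reflecting both indices into the lower half makes strict monotonicity applicable. *)
  define g where "g k = (2 * k choose k) * (2 * (N - k) choose (N - k))" for k
  have refl: "g (min k (N - k)) = g k" if "k \<le> N" for k
    using that by (cases "k \<le> N - k") (auto simp: g_def min_def)
  have "g (min i (N - i)) = g (min j (N - j))"
    using assms refl by (simp add: g_def)
  moreover have "2 * min i (N - i) \<le> N" "2 * min j (N - j) \<le> N"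
    by auto
  ultimately have "min i (N - i) = min j (N - j)"
    using central_binomial_product_strict_decreasing[of _ _ N]
    unfolding g_def by (metis nat_less_le linorder_neqE_nat)
  then show ?thesis
    using assms by (auto simp: min_def split: if_splits)
qed

definition common_neighbours :: "nat \<Rightarrow> word \<Rightarrow> word \<Rightarrow> word set" where
  "common_neighbours n x y = {z \<in> cube n. weight (x + z) = n div 2 \<and> weight (y + z) = n div 2}"

lemma card_common_neighbours:
  assumes "even n" and x: "x \<in> cube n" and y: "y \<in> cube n"
  shows "card (common_neighbours n x y) =
    (let k = weight (x + y) div 2 in
     if even (weight (x + y)) then (2 * k choose k) * (2 * (n div 2 - k) choose (n div 2 - k)) else 0)"
proof -
  let ?Z = "{z \<in> cube n. weight z = n div 2 \<and> weight (z + (x + y)) = n div 2}"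
  have *: "x + z + (x + y) = y + z" for z
    by (metis add.commute add.left_commute word_add_add_self)
  have **: "weight (x + (y + z)) = weight (z + (x + y))" for z
    by (simp only: ac_simps)
  have "bij_betw (\<lambda>z. x + z) (common_neighbours n x y) ?Z"
  proof (rule bij_betw_byWitness[where f' = "\<lambda>z. x + z"])
    show "(+) x ` common_neighbours n x y \<subseteq> ?Z"
      using x by (auto simp: common_neighbours_def *)
    show "(+) x ` ?Z \<subseteq> common_neighbours n x y"
      using x y by (auto simp: common_neighbours_def ac_simps)
  qed auto
  then have "card (common_neighbours n x y) = card ?Z"
    by (rule bij_betw_same_card)
  moreover have "n - weight (x + y) = 2 * (n div 2 - weight (x + y) div 2)" if "even (weight (x + y))"
    using that \<open>even n\<close> by (metis diff_mult_distrib2 dvd_mult_div_cancel)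
  ultimately show ?thesis
    using card_halving_words[of "x + y" n "n div 2"] weight_le[of "x + y" n] assms
    by (auto simp: Let_def)
qed

text \<open>
  An isometry is only assumed to preserve the distance \<open>n/2\<close> in one direction. All words have
  equally many neighbours, however, so \<open>\<phi>\<close> maps the neighbourhood of \<open>x\<close> onto that of \<open>\<phi> x\<close>.
\<close>

lemma isometry_common_neighbours:
  assumes iso: "cube_isometry n {n div 2, n} \<phi>" and x: "x \<in> cube n" and y: "y \<in> cube n"
  shows "card (common_neighbours n (\<phi> x) (\<phi> y)) = card (common_neighbours n x y)"
proof -
  let ?N = "\<lambda>x. {z \<in> cube n. weight (x + z) = n div 2}"
  have bij: "bij_betw \<phi> (cube n) (cube n)"
    using iso by (simp add: cube_isometry_def)
  have pres: "weight (\<phi> x + \<phi> z) = n div 2" if "x \<in> cube n" "z \<in> cube n" "weight (x + z) = n div 2" for x z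
    using iso that by (auto simp: cube_isometry_def hamming_dist_eq_weight)
  have inj: "inj_on \<phi> (cube n)"
    using bij by (simp add: bij_betw_def)
  have \<phi>_cube: "\<phi> z \<in> cube n" if "z \<in> cube n" for z
    using bij that by (auto simp: bij_betw_def)
  have card_N: "card (?N x) = card (?N 0)" if "x \<in> cube n" for x
  proof (rule bij_betw_same_card[of "\<lambda>z. x + z"], rule bij_betw_byWitness[where f' = "\<lambda>z. x + z"])
  qed (use that in auto)
  have img: "\<phi> ` ?N x = ?N (\<phi> x)" if "x \<in> cube n" for x
  proof (rule card_subset_eq)
    show "finite (?N (\<phi> x))"
      using finite_cube by auto
    show "\<phi> ` ?N x \<subseteq> ?N (\<phi> x)"
      using pres \<phi>_cube that by auto
    have "card (\<phi> ` ?N x) = card (?N x)"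
      using inj that by (intro card_image) (auto intro: inj_on_subset)
    then show "card (\<phi> ` ?N x) = card (?N (\<phi> x))"
      using card_N \<phi>_cube that by simp
  qed
  have "common_neighbours n x y = ?N x \<inter> ?N y" for x y
    by (auto simp: common_neighbours_def)
  then have "common_neighbours n (\<phi> x) (\<phi> y) = \<phi> ` common_neighbours n x y"
    using inj_on_image_Int[OF inj, of "?N x" "?N y"] img x y by simp
  moreover have "inj_on \<phi> (common_neighbours n x y)"
    using inj by (rule inj_on_subset) (auto simp: common_neighbours_def)
  ultimately show ?thesis
    by (simp add: card_image)
qed

lemma isometry_folded_distance:
  assumes iso: "cube_isometry n {n div 2, n} \<phi>" and "even n" and x: "x \<in> cube n" and y: "y \<in> cube n"
  shows "even (weight (\<phi> x + \<phi> y)) \<longleftrightarrow> even (weight (x + y))"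
    and "even (weight (x + y)) \<Longrightarrow> weight (\<phi> x + \<phi> y) \<in> {weight (x + y), n - weight (x + y)}"
proof -
  have \<phi>: "\<phi> x \<in> cube n" "\<phi> y \<in> cube n"
    using iso x y by (auto simp: cube_isometry_def bij_betw_def)
  let ?g = "\<lambda>k. (2 * k choose k) * (2 * (n div 2 - k) choose (n div 2 - k))"
  have pos: "?g k > 0" for k
    by simp
  have eq: "(if even (weight (\<phi> x + \<phi> y)) then ?g (weight (\<phi> x + \<phi> y) div 2) else 0) =
    (if even (weight (x + y)) then ?g (weight (x + y) div 2) else 0)"
    using isometry_common_neighbours[OF iso x y]
    unfolding card_common_neighbours[OF \<open>even n\<close> x y] card_common_neighbours[OF \<open>even n\<close> \<phi>] Let_def .
  then show par: "even (weight (\<phi> x + \<phi> y)) \<longleftrightarrow> even (weight (x + y))"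
    using pos by (metis less_numeral_extra(3))
  assume ev: "even (weight (x + y))"
  have "weight (x + y) \<le> n" "weight (\<phi> x + \<phi> y) \<le> n"
    using x y \<phi> by (auto intro: weight_le)
  moreover have "?g (weight (x + y) div 2) = ?g (weight (\<phi> x + \<phi> y) div 2)"
    using eq ev par by (simp only: if_True)
  ultimately have "weight (\<phi> x + \<phi> y) div 2 = weight (x + y) div 2 \<or>
      weight (\<phi> x + \<phi> y) div 2 = n div 2 - weight (x + y) div 2"
    by (intro central_binomial_product_inj) (auto simp: div_le_mono)
  then show "weight (\<phi> x + \<phi> y) \<in> {weight (x + y), n - weight (x + y)}"
    using ev par \<open>even n\<close> by (auto elim!: evenE)
qed


section \<open>Maps preserving folded distances between even words\<close>

text \<open>
  Three pairwise intersecting pairs without a common point form a triangle, and no fourth pair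
  meets all its edges.
\<close>

lemma pairwise_meeting_pairs_common_point:
  fixes \<A> :: "'a set set"
  assumes card2: "\<And>S. S \<in> \<A> \<Longrightarrow> card S = 2"
    and meet: "\<And>S T. S \<in> \<A> \<Longrightarrow> T \<in> \<A> \<Longrightarrow> S \<inter> T \<noteq> {}"
    and card4: "4 \<le> card \<A>"
  shows "\<exists>v. \<forall>S\<in>\<A>. v \<in> S"
proof (rule ccontr)
  assume no: "\<nexists>v. \<forall>S\<in>\<A>. v \<in> S"
  have large: "\<not> \<A> \<subseteq> F" if "finite F" "card F \<le> 3" for F
    using card_mono[OF that(1), of \<A>] that(2) card4 by linarith
  obtain S where S: "S \<in> \<A>"
    using card4 by fastforce
  obtain a b where ab: "S = {a, b}" "a \<noteq> b"
    using card2[OF S] by (auto simp: card_2_iff)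
  obtain T where T: "T \<in> \<A>" "a \<notin> T"
    using no by blast
  obtain c where c: "T = {b, c}" "b \<noteq> c" "a \<noteq> c"
    using card2[OF T(1)] meet[OF S T(1)] T(2) ab by (auto simp: card_2_iff)
  obtain U where U: "U \<in> \<A>" "b \<notin> U"
    using no by blast
  have U_eq: "U = {a, c}"
    using card2[OF U(1)] meet[OF S U(1)] meet[OF T(1) U(1)] U(2) ab c by (auto simp: card_2_iff)
  have "card {{a, b}, {b, c}, {a, c}} \<le> 3"
    by (simp add: card_insert_if)
  then obtain V where V: "V \<in> \<A>" "V \<notin> {{a, b}, {b, c}, {a, c}}"
    using large by (metis finite.emptyI finite_insert subsetI)
  obtain p q where pq: "V = {p, q}" "p \<noteq> q"
    using card2[OF V(1)] by (auto simp: card_2_iff)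
  show False
    using meet[OF S V(1)] meet[OF T(1) V(1)] meet[OF U(1) V(1)] V(2) ab c U_eq pq
    by auto
qed

text \<open>
  The words \<open>g j\<close> stand for the images of the \<open>n - 1\<close> edges \<open>{1, j}\<close> of the star at \<open>1\<close>, known only
  up to complement; the claim is that they again form a star up to complement.
\<close>

lemma star_representatives:
  assumes n: "4 dvd n" "n > 0"
    and cube: "\<And>j. j \<in> {2..n} \<Longrightarrow> g j \<in> cube n"
    and weight: "\<And>j. j \<in> {2..n} \<Longrightarrow> weight (g j) \<in> {2, n - 2}"
    and dist: "\<And>j k. j \<in> {2..n} \<Longrightarrow> k \<in> {2..n} \<Longrightarrow> j \<noteq> k \<Longrightarrow> weight (g j + g k) \<in> {2, n - 2}"
  shows "\<exists>v\<in>{1..n}. \<forall>j\<in>{2..n}. \<exists>k\<in>{1..n}. k \<noteq> v \<and>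
    g j \<in> {char_word {v, k}, char_word {v, k} + ones n}"
proof -
  have n4: "n \<ge> 4"
    using n by (auto intro: dvd_imp_le)
  have "\<exists>e v. \<forall>j\<in>{2..n}. e j \<in> {g j, g j + ones n} \<and> weight (e j) = 2 \<and> v \<in> supp (e j)"
  proof (cases "n = 4")
    case True
    (* Each complementary pair of words of weight 2 has one member containing the coordinate 1. *)
    define e where "e j = (if g j 1 = 1 then g j else g j + ones n)" for j
    have "e j \<in> {g j, g j + ones n} \<and> weight (e j) = 2 \<and> 1 \<in> supp (e j)" if j: "j \<in> {2..n}" for j
      using weight[OF j] weight_add_ones[OF cube[OF j]] True
      by (auto simp: e_def supp_def ones_def)
    then show ?thesis by blast
  next
    case False
    with n have n8: "n \<ge> 8"
      by (auto elim!: dvdE)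
    define e where "e j = (if weight (g j) = 2 then g j else g j + ones n)" for j
    have e: "e j \<in> {g j, g j + ones n}" "weight (e j) = 2" "e j \<in> cube n" if j: "j \<in> {2..n}" for j
      using weight[OF j] weight_add_ones[OF cube[OF j]] cube[OF j] n8 by (auto simp: e_def)
    have meet: "supp (e j) \<inter> supp (e k) \<noteq> {} \<and> supp (e j) \<noteq> supp (e k)"
      if j: "j \<in> {2..n}" and k: "k \<in> {2..n}" and "j \<noteq> k" for j k
    proof -
      have "e j + e k \<in> {g j + g k, g j + g k + ones n}"
        using e(1)[OF j] e(1)[OF k] by (auto simp: ac_simps)
      then have "weight (e j + e k) \<in> {2, n - 2}"
        using dist[OF that] weight_add_ones[of "g j + g k" n] cube[OF j] cube[OF k] n8 by auto
      moreover have "weight (e j + e k) + 2 * card (supp (e j) \<inter> supp (e k)) = 4"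
        using weight_add[OF e(3)[OF j] e(3)[OF k]] e(2) j k by simp
      (* The sum of two words of weight 2 has weight at most 4, which is less than n - 2. *)
      ultimately have "card (supp (e j) \<inter> supp (e k)) = 1"
        using n8 by auto
      moreover have "card (supp (e j)) = 2"
        using e(2)[OF j] by (simp add: weight_eq_card_supp)
      ultimately show ?thesis by auto
    qed
    let ?A = "(\<lambda>j. supp (e j)) ` {2..n}"
    have card2: "card (supp (e j)) = 2" if "j \<in> {2..n}" for j
      using e(2)[OF that] by (simp add: weight_eq_card_supp)
    have "inj_on (\<lambda>j. supp (e j)) {2..n}"
      using meet by (meson inj_onI)
    then have "4 \<le> card ?A"
      using n8 by (simp add: card_image)
    moreover have "S \<inter> T \<noteq> {}" if ST: "S \<in> ?A" "T \<in> ?A" for S T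
    proof -
      obtain j k where jk: "j \<in> {2..n}" "k \<in> {2..n}" "S = supp (e j)" "T = supp (e k)"
        using ST by blast
      show ?thesis
        using meet[OF jk(1,2)] card2[OF jk(1)] jk by (cases "j = k") auto
    qed
    moreover have "card S = 2" if "S \<in> ?A" for S
      using that card2 by blast
    ultimately obtain v where "\<forall>S\<in>?A. v \<in> S"
      using pairwise_meeting_pairs_common_point[of ?A] by blast
    then show ?thesis
      using e by blast
  qed
  then obtain e v where ev: "\<forall>j\<in>{2..n}. e j \<in> {g j, g j + ones n} \<and> weight (e j) = 2 \<and> v \<in> supp (e j)"
    by blast
  have e: "e j \<in> {g j, g j + ones n}" and e2: "card (supp (e j)) = 2" and v: "v \<in> supp (e j)"
    if "j \<in> {2..n}" for j
    using ev that by (simp_all add: weight_eq_card_supp)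
  have e_cube: "supp (e j) \<subseteq> {1..n}" if "j \<in> {2..n}" for j
    unfolding mem_cube_iff[symmetric] using e[OF that] cube[OF that] by auto
  have "\<exists>k\<in>{1..n}. k \<noteq> v \<and> g j \<in> {char_word {v, k}, char_word {v, k} + ones n}" if j: "j \<in> {2..n}" for j
  proof -
    obtain p q where "supp (e j) = {p, q}" "p \<noteq> q"
      using e2[OF j] by (auto simp: card_2_iff)
    with v[OF j] have "q \<noteq> v \<and> supp (e j) = {v, q} \<or> p \<noteq> v \<and> supp (e j) = {v, p}"
      by auto
    then obtain k where k: "k \<noteq> v" "supp (e j) = {v, k}"
      by blast
    then have "e j = char_word {v, k}"
      by (metis char_word_supp)
    moreover have "g j \<in> {e j, e j + ones n}"
      using e[OF j] by (auto simp: add.assoc)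
    ultimately show ?thesis
      using k e_cube[OF j] by auto
  qed
  moreover have "v \<in> {1..n}"
    using v[of 2] e_cube[of 2] n4 by auto
  ultimately show ?thesis by blast
qed

lemma weight_add_pair:
  assumes "x \<in> cube n" "i \<in> {1..n}" "j \<in> {1..n}" "i \<noteq> j"
  obtains m where "weight (x + char_word {i, j}) + 2 * m = weight x + 2" "m \<le> 2"
    "m = 1 \<longleftrightarrow> x i \<noteq> x j"
proof
  let ?m = "card (supp x \<inter> {i, j})"
  have "char_word {i, j} \<in> cube n"
    using assms by (auto simp: mem_cube_iff)
  from weight_add[OF assms(1) this]
  show "weight (x + char_word {i, j}) + 2 * ?m = weight x + 2"
    using assms(4) by (simp add: weight_eq_card_supp)
  show "?m \<le> 2" "?m = 1 \<longleftrightarrow> x i \<noteq> x j"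
    using assms(4) by (cases "x i"; cases "x j"; simp add: supp_def)+
qed

text \<open>
  Adding the word of a pair changes the weight of \<open>x\<close> by \<open>0\<close> if \<open>x\<close> separates the pair, and by
  \<open>2\<close> or \<open>-2\<close> otherwise. Modulo \<open>4\<close> these cases differ, and for even weights the passage from
  \<open>w\<close> to \<open>n - w\<close> is invisible modulo \<open>4\<close> because \<open>4\<close> divides \<open>n\<close>.
\<close>

lemma separation_from_folded_distance:
  assumes n: "4 dvd n" and x: "x \<in> even_words n" and y: "y \<in> cube n"
    and ij: "i \<in> {1..n}" "j \<in> {1..n}" "i \<noteq> j" and kl: "k \<in> {1..n}" "l \<in> {1..n}" "k \<noteq> l"
    and weight: "weight y \<in> {weight x, n - weight x}"
    and pair: "weight (y + char_word {k, l}) \<in>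
      {weight (x + char_word {i, j}), n - weight (x + char_word {i, j})}"
  shows "x i \<noteq> x j \<longleftrightarrow> y k \<noteq> y l"
proof -
  have x': "x \<in> cube n" "even (weight x)"
    using x by (auto simp: even_words_def)
  obtain m where m: "weight (x + char_word {i, j}) + 2 * m = weight x + 2" "m \<le> 2"
    "m = 1 \<longleftrightarrow> x i \<noteq> x j"
    using weight_add_pair[OF x'(1) ij] .
  obtain m' where m': "weight (y + char_word {k, l}) + 2 * m' = weight y + 2" "m' \<le> 2"
    "m' = 1 \<longleftrightarrow> y k \<noteq> y l"
    using weight_add_pair[OF y kl] .
  have "char_word {i, j} \<in> cube n"
    using ij by (auto simp: mem_cube_iff)
  then have "x + char_word {i, j} \<in> cube n"
    using x' by blast
  then have le: "weight x \<le> n" "weight (x + char_word {i, j}) \<le> n"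
    using x' by (auto intro: weight_le)
  obtain q where q: "n = 4 * q"
    using n by blast
  obtain w where w: "weight x = 2 * w"
    using x'(2) by blast
  have "weight y = 2 * w \<or> weight y + 2 * w = 4 * q"
    using weight le q w by auto
  moreover have "weight (y + char_word {k, l}) + 2 * m = 2 * w + 2 \<or>
      weight (y + char_word {k, l}) + 2 * w + 2 = 4 * q + 2 * m"
    using pair le q w m(1) by auto
  ultimately have "even (m + m')"
    using m'(1) by (elim disjE; presburger)
  then have "m = 1 \<longleftrightarrow> m' = 1"
    using m(2) m'(2) by presburger
  with m(3) m'(3) show ?thesis by simp
qed

lemma folded_isometry_is_permutation:
  assumes n: "4 dvd n" "n > 0"
    and cube: "\<And>x. x \<in> even_words n \<Longrightarrow> f x \<in> cube n"
    and f0: "f 0 \<in> {0, ones n}"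
    and dist: "\<And>x y. x \<in> even_words n \<Longrightarrow> y \<in> even_words n \<Longrightarrow>
      weight (f x + f y) \<in> {weight (x + y), n - weight (x + y)}"
  shows "\<exists>\<pi>. \<pi> permutes {1..n} \<and>
    (\<forall>x\<in>even_words n. f x \<in> {perm_word \<pi> x, perm_word \<pi> x + ones n})"
proof -
  have n4: "n \<ge> 4"
    using n by (auto intro: dvd_imp_le)
  have E_cube: "x \<in> cube n" if "x \<in> even_words n" for x
    using that by (simp add: even_words_def)
  have weight_f: "weight (f x) \<in> {weight x, n - weight x}" if x: "x \<in> even_words n" for x
  proof -
    have "0 \<in> even_words n"
      by (simp add: even_words_def)
    from dist[OF x this] show ?thesis
      using f0 weight_add_ones[OF cube[OF x]] weight_le[OF cube[OF x]] weight_le[OF E_cube[OF x]] by auto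
  qed
  let ?pair = "\<lambda>j. char_word {1, j}"
  have pair_E: "?pair j \<in> even_words n" and weight_pair: "weight (?pair j) = 2" if "j \<in> {2..n}" for j
    using that by (auto simp: even_words_def mem_cube_iff weight_eq_card_supp)
  have pair_dist: "weight (?pair j + ?pair k) = 2" if "j \<in> {2..n}" "k \<in> {2..n}" "j \<noteq> k" for j k
  proof -
    have "{1, j} \<inter> {1, k} = {1}"
      using that by auto
    then show ?thesis
      using weight_add[OF E_cube E_cube, OF pair_E pair_E, of j k] that weight_pair by simp
  qed
  have f_pair_dist: "weight (f (?pair j) + f (?pair k)) \<in> {2, n - 2}"
    if "j \<in> {2..n}" "k \<in> {2..n}" "j \<noteq> k" for j k
    using dist[OF pair_E pair_E, of j k] pair_dist that by simp
  have "\<exists>v\<in>{1..n}. \<forall>j\<in>{2..n}. \<exists>k\<in>{1..n}. k \<noteq> v \<and>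
      f (?pair j) \<in> {char_word {v, k}, char_word {v, k} + ones n}"
  proof (rule star_representatives[OF n])
    show "weight (f (?pair j)) \<in> {2, n - 2}" if "j \<in> {2..n}" for j
      using weight_f[OF pair_E[OF that]] weight_pair[OF that] by simp
  qed (use cube pair_E f_pair_dist in auto)
  then obtain v where v: "v \<in> {1..n}"
    and "\<forall>j\<in>{2..n}. \<exists>k. k \<in> {1..n} \<and> k \<noteq> v \<and> f (?pair j) \<in> {char_word {v, k}, char_word {v, k} + ones n}"
    by blast
  then obtain h where h: "\<And>j. j \<in> {2..n} \<Longrightarrow> h j \<in> {1..n}" "\<And>j. j \<in> {2..n} \<Longrightarrow> h j \<noteq> v"
    "\<And>j. j \<in> {2..n} \<Longrightarrow> f (?pair j) \<in> {char_word {v, h j}, char_word {v, h j} + ones n}"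
    by metis
  define p where "p j = (if j = 1 then v else if j \<in> {2..n} then h j else j)" for j
  have h_inj: "j = k" if jk: "j \<in> {2..n}" "k \<in> {2..n}" "h j = h k" for j k
  proof (rule ccontr)
    assume "j \<noteq> k"
    have "f (?pair j) + f (?pair k) \<in> {0, ones n}"
      using h(3)[OF jk(1)] h(3)[OF jk(2)] jk(3) by (auto simp: ac_simps)
    then have "weight (f (?pair j) + f (?pair k)) \<in> {0, n}"
      by auto
    with f_pair_dist[OF jk(1,2) \<open>j \<noteq> k\<close>] n4 show False by auto
  qed
  have one_or: "j = 1 \<or> j \<in> {2..n}" if "j \<in> {1..n}" for j
    using that by auto
  have "inj_on p {1..n}"
    using h(2) h_inj one_or unfolding inj_on_def p_def by metis
  moreover have "p ` {1..n} \<subseteq> {1..n}"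
    using v h(1) by (auto simp: p_def)
  ultimately have "bij_betw p {1..n} {1..n}"
    by (simp add: bij_betw_def endo_inj_surj)
  moreover have "p j = j" if "j \<notin> {1..n}" for j
    using that n by (auto simp: p_def)
  ultimately have p: "p permutes {1..n}"
    by (rule bij_imp_permutes)
  have "f x \<in> {perm_word (inv p) x, perm_word (inv p) x + ones n}" if x: "x \<in> even_words n" for x
  proof -
    let ?y = "f x"
    have sep: "x 1 \<noteq> x j \<longleftrightarrow> ?y v \<noteq> ?y (h j)" if j: "j \<in> {2..n}" for j
    proof (rule separation_from_folded_distance[OF n(1) x cube[OF x]])
      have "f x + char_word {v, h j} \<in> {f x + f (?pair j), f x + f (?pair j) + ones n}"
        using h(3)[OF j] by (auto simp: add.assoc)
      moreover have in_cube: "f x + f (?pair j) \<in> cube n" "x + ?pair j \<in> cube n"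
        using cube x pair_E[OF j] E_cube by auto
      ultimately have "weight (f x + char_word {v, h j}) \<in>
          {weight (f x + f (?pair j)), n - weight (f x + f (?pair j))}"
        using weight_add_ones[OF in_cube(1)] by (metis insert_iff singletonD)
      then show "weight (?y + char_word {v, h j}) \<in> {weight (x + ?pair j), n - weight (x + ?pair j)}"
        using dist[OF x pair_E[OF j]] weight_le[OF in_cube(2)] by auto
    qed (use j h[OF j] v weight_f[OF x] in auto)
    (* Hence y composed with p differs from x by the same constant at every coordinate. *)
    have const: "?y (p j) = x j + (x 1 + ?y v)" if j: "j \<in> {1..n}" for j
    proof (cases "j = 1")
      case True
      then show ?thesis
        by (cases "x 1"; cases "?y v") (auto simp: p_def)
    next
      case False
      with j have "j \<in> {2..n}" by auto
      with sep[OF this] False show ?thesis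
        by (cases "x 1"; cases "?y v"; cases "x j"; cases "?y (h j)") (auto simp: p_def)
    qed
    have inv_p: "inv p permutes {1..n}"
      using p by (rule permutes_inv)
    have y_eq: "?y i = perm_word (inv p) x i + (if i \<in> {1..n} then x 1 + ?y v else 0)" for i
    proof (cases "i \<in> {1..n}")
      case True
      then have "inv p i \<in> {1..n}"
        using permutes_in_image[OF inv_p] by blast
      from const[OF this] show ?thesis
        using True permutes_inverses(1)[OF p] by (simp add: perm_word_def)
    next
      case False
      then have "inv p i = i" "x i = 0" "?y i = 0"
        using permutes_not_in[OF inv_p] E_cube[OF x] cube[OF x] by (auto simp: cube_def)
      with False show ?thesis by (simp only: perm_word_def comp_apply if_False add_0)
    qed
    show ?thesis
    proof (cases "x 1 + ?y v = 0")
      case True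
      with y_eq have "?y = perm_word (inv p) x"
        by (simp only: fun_eq_iff if_cancel add_0_right simp_thms)
      then show ?thesis by blast
    next
      case False
      then have "x 1 + ?y v = 1"
        by (simp only: bit_not_zero_iff)
      with y_eq have "?y = perm_word (inv p) x + ones n"
        by (simp only: fun_eq_iff plus_fun_apply ones_def simp_thms)
      then show ?thesis by blast
    qed
  qed
  with permutes_inv[OF p] show ?thesis by blast
qed


section \<open>Permutations twisted by complements\<close>

definition twist :: "nat \<Rightarrow> (nat \<Rightarrow> nat) \<Rightarrow> word set \<Rightarrow> word \<Rightarrow> word" where
  "twist n \<pi> S c = perm_word \<pi> c + (if {c, ones n + c} \<inter> S = {} then 0 else ones n)"

lemma formula_map_eq_twist:
  "formula_map n \<pi>\<^sub>1 \<pi>\<^sub>2 S\<^sub>1 S\<^sub>2 a b c =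
    (if c \<in> even_words n then twist n \<pi>\<^sub>1 S\<^sub>1 c else b + twist n \<pi>\<^sub>2 S\<^sub>2 (c + a))"
  by (simp add: formula_map_def twist_def add.assoc)

lemma perm_word_add: "perm_word \<pi> (x + y) = perm_word \<pi> x + perm_word \<pi> y"
  by (simp add: perm_word_def fun_eq_iff)

lemma perm_word_in_cube:
  assumes "\<pi> permutes {1..n}" "x \<in> cube n"
  shows "perm_word \<pi> x \<in> cube n"
  using assms permutes_not_in[OF assms(1)] by (simp add: cube_def perm_word_def)

lemma weight_perm_word:
  assumes "\<pi> permutes {1..n}"
  shows "weight (perm_word \<pi> x) = weight x"
proof -
  have "bij \<pi>"
    using assms by (rule permutes_bij)
  have "supp (perm_word \<pi> x) = \<pi> -` supp x"
    by (auto simp: supp_def perm_word_def)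
  then show ?thesis
    unfolding weight_eq_card_supp using \<open>bij \<pi>\<close> by (simp add: card_vimage_inj bij_def)
qed

lemma perm_word_ones:
  assumes "\<pi> permutes {1..n}"
  shows "perm_word \<pi> (ones n) = ones n"
  using weight_eq_n_iff[OF perm_word_in_cube[OF assms ones_in_cube]] weight_perm_word[OF assms] by simp

lemma twist_add_ones:
  assumes "\<pi> permutes {1..n}"
  shows "twist n \<pi> S (x + ones n) = twist n \<pi> S x + ones n"
proof -
  have "ones n + (x + ones n) = x"
    by (metis add.commute word_add_add_self)
  then have "{x + ones n, ones n + (x + ones n)} = {x, ones n + x}"
    by (auto simp: add.commute)
  then show ?thesis
    by (simp add: twist_def perm_word_add perm_word_ones[OF assms] ac_simps)
qed

lemma twist_in_cube:
  assumes "\<pi> permutes {1..n}" "x \<in> cube n"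
  shows "twist n \<pi> S x \<in> cube n"
  using perm_word_in_cube[OF assms] by (auto simp: twist_def)

lemma weight_twist_add_twist:
  assumes \<pi>: "\<pi> permutes {1..n}" and x: "x \<in> cube n" and y: "y \<in> cube n"
  shows "weight (twist n \<pi> S x + twist n \<pi> S y) \<in> {weight (x + y), n - weight (x + y)}"
proof -
  let ?z = "perm_word \<pi> (x + y)"
  have "twist n \<pi> S x + twist n \<pi> S y \<in> {?z, ?z + ones n}"
    by (auto simp: twist_def perm_word_add ac_simps)
  then show ?thesis
    using weight_add_ones[of ?z n] perm_word_in_cube[OF \<pi>, of "x + y"] weight_perm_word[OF \<pi>, of "x + y"] x y
    by auto
qed

lemma cube_complement_iff:
  assumes "x \<in> cube n" "y \<in> cube n"
  shows "weight (x + y) = n \<longleftrightarrow> y = x + ones n"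
  using weight_eq_n_iff[of "x + y" n] assms by (metis add_in_cube word_add_add_self)

text \<open>
  Folded preservation of distances would allow the distance \<open>n\<close> to become \<open>0\<close>; this is
  excluded because the choice of complement in \<open>twist\<close> depends only on the antipodal pair.
\<close>

lemma weight_twist_eq_n:
  assumes \<pi>: "\<pi> permutes {1..n}" and "x \<in> cube n" "y \<in> cube n" "weight (x + y) = n"
  shows "weight (twist n \<pi> S x + twist n \<pi> S y) = n"
  using cube_complement_iff[OF assms(2,3)] assms(4) twist_add_ones[OF \<pi>, of S x]
  by simp

lemma twist_inj:
  assumes \<pi>: "\<pi> permutes {1..n}" and "n > 0" and x: "x \<in> cube n" and y: "y \<in> cube n"
    and eq: "twist n \<pi> S x = twist n \<pi> S y"
  shows "x = y"
proof -
  have "weight (x + y) = 0 \<or> weight (x + y) = n"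
    using weight_twist_add_twist[OF \<pi> x y, of S] weight_le[of "x + y" n] eq x y by auto
  moreover have "weight (x + y) \<noteq> n"
    using weight_twist_eq_n[OF \<pi> x y, of S] eq \<open>n > 0\<close> by auto
  ultimately show ?thesis
    using weight_eq_0_iff[of "x + y" n] x y by (simp add: word_add_eq_0_iff)
qed

lemma even_weight_twist:
  assumes "even n" "\<pi> permutes {1..n}" "x \<in> cube n"
  shows "even (weight (twist n \<pi> S x)) \<longleftrightarrow> even (weight x)"
proof -
  have "even (weight (if {x, ones n + x} \<inter> S = {} then 0 else ones n))"
    using \<open>even n\<close> by simp
  then show ?thesis
    unfolding twist_def
    using even_weight_add[OF perm_word_in_cube[OF assms(2,3)], of "if {x, ones n + x} \<inter> S = {} then 0 else ones n"]
      weight_perm_word[OF assms(2)] by simp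
qed

lemma even_X_words_representative:
  assumes n: "4 dvd n" "n > 0" and x: "x \<in> even_words n"
  shows "x \<in> even_X_words n \<or> ones n + x \<in> even_X_words n"
proof -
  have "x \<in> cube n" "even (weight x)"
    using x by (auto simp: even_words_def)
  moreover have "weight (ones n + x) = n - weight x" "weight x \<le> n"
    using weight_add_ones[of x n] weight_le[of x n] calculation by (auto simp: add.commute)
  moreover have "(ones n + x) 1 = 0 \<longleftrightarrow> x 1 \<noteq> 0"
    using n by (cases "x 1") (auto simp: ones_def)
  moreover have "even n"
    using n(1) by auto
  ultimately show ?thesis
    by (auto simp: even_X_words_def X_words_def even_words_def elim!: evenE)
qed

text \<open>
  The set \<open>S\<close> collects the representatives of those antipodal pairs on which \<open>f\<close> complements. As
  \<open>f\<close> commutes with complementation, it is enough to look at one word of each pair.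
\<close>

lemma twist_of_permutation_up_to_complement:
  assumes n: "4 dvd n" "n > 0" and \<pi>: "\<pi> permutes {1..n}"
    and f: "\<And>x. x \<in> even_words n \<Longrightarrow> f x \<in> {perm_word \<pi> x, perm_word \<pi> x + ones n}"
    and f_ones: "\<And>x. x \<in> even_words n \<Longrightarrow> f (ones n + x) = f x + ones n"
  shows "\<exists>S\<subseteq>even_X_words n. \<forall>x\<in>even_words n. f x = twist n \<pi> S x"
proof (intro exI conjI ballI)
  let ?S = "{x \<in> even_X_words n. f x \<noteq> perm_word \<pi> x}"
  show "?S \<subseteq> even_X_words n" by blast
  fix x assume x: "x \<in> even_words n"
  have same: "f (ones n + x) = perm_word \<pi> (ones n + x) \<longleftrightarrow> f x = perm_word \<pi> x"
    unfolding f_ones[OF x] perm_word_add perm_word_ones[OF \<pi>] by (simp add: add.commute)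
  have "{x, ones n + x} \<inter> ?S = {} \<longleftrightarrow> f x = perm_word \<pi> x"
    using even_X_words_representative[OF n x] same by auto
  then show "f x = twist n \<pi> ?S x"
    using f[OF x] by (auto simp: twist_def)
qed

section \<open>The classification\<close>

lemma folded_isometry_is_twist:
  assumes n: "4 dvd n" "n > 0"
    and cube: "\<And>x. x \<in> even_words n \<Longrightarrow> f x \<in> cube n"
    and f0: "f 0 \<in> {0, ones n}"
    and dist: "\<And>x y. x \<in> even_words n \<Longrightarrow> y \<in> even_words n \<Longrightarrow>
      weight (f x + f y) \<in> {weight (x + y), n - weight (x + y)}"
    and antipodal: "\<And>x y. x \<in> even_words n \<Longrightarrow> y \<in> even_words n \<Longrightarrow>
      weight (x + y) = n \<Longrightarrow> weight (f x + f y) = n"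
  shows "\<exists>\<pi> S. \<pi> permutes {1..n} \<and> S \<subseteq> even_X_words n \<and> (\<forall>x\<in>even_words n. f x = twist n \<pi> S x)"
proof -
  obtain \<pi> where \<pi>: "\<pi> permutes {1..n}"
    "\<And>x. x \<in> even_words n \<Longrightarrow> f x \<in> {perm_word \<pi> x, perm_word \<pi> x + ones n}"
    using folded_isometry_is_permutation[OF n cube f0 dist] by blast
  have "f (ones n + x) = f x + ones n" if x: "x \<in> even_words n" for x
  proof -
    have E: "ones n + x \<in> even_words n"
      using x n(1) even_weight_add[of "ones n" n x] by (auto simp: even_words_def)
    have "weight (x + (ones n + x)) = n"
      by (simp add: add.commute)
    from antipodal[OF x E this] show ?thesis
      using cube_complement_iff[OF cube[OF x] cube[OF E]] by simp
  qed
  from twist_of_permutation_up_to_complement[OF n \<pi> this] \<pi>(1) show ?thesis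
    by blast
qed

lemma isometry_is_formula_map:
  assumes n: "4 dvd n" "n > 0"
    and iso: "cube_isometry n {n div 2, n} \<phi>" and fix01: "\<phi> ` {0, ones n} = {0, ones n}"
  shows "\<exists>\<pi>\<^sub>1 \<pi>\<^sub>2 S\<^sub>1 S\<^sub>2 a b.
    \<pi>\<^sub>1 permutes {1..n} \<and> \<pi>\<^sub>2 permutes {1..n} \<and>
    S\<^sub>1 \<subseteq> even_X_words n \<and> S\<^sub>2 \<subseteq> even_X_words n \<and>
    a \<in> odd_words n \<and> b \<in> odd_words n \<and>
    (\<forall>c\<in>cube n. \<phi> c = formula_map n \<pi>\<^sub>1 \<pi>\<^sub>2 S\<^sub>1 S\<^sub>2 a b c)"
proof -
  have "even n" using n(1) by auto
  note par = isometry_folded_distance(1)[OF iso \<open>even n\<close>]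
    and dist = isometry_folded_distance(2)[OF iso \<open>even n\<close>]
  have \<phi>_cube: "\<phi> x \<in> cube n" if "x \<in> cube n" for x
    using iso that by (auto simp: cube_isometry_def bij_betw_def)
  have antipodal: "weight (\<phi> x + \<phi> y) = n" if "x \<in> cube n" "y \<in> cube n" "weight (x + y) = n" for x y
    using iso that by (auto simp: cube_isometry_def hamming_dist_eq_weight)
  have \<phi>0: "\<phi> 0 \<in> {0, ones n}"
    using fix01 by blast
  have E: "x \<in> cube n" "even (weight x)" if "x \<in> even_words n" for x
    using that by (auto simp: even_words_def)
  have EE: "even (weight (x + y))" if "x \<in> even_words n" "y \<in> even_words n" for x y
    using E that even_weight_add by blast

  define a where "a = char_word {1}"
  have a: "a \<in> cube n" "odd (weight a)"
    using n(2) by (auto simp: a_def mem_cube_iff weight_eq_card_supp)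
  define b where "b = \<phi> a"
  have b: "b \<in> cube n"
    using \<phi>_cube a by (simp add: b_def)
  have "odd (weight (b + \<phi> 0))"
    using par[of a 0] a by (simp add: b_def)
  then have b_odd: "odd (weight b)"
    using even_weight_add[OF b \<phi>_cube[OF zero_in_cube]] \<phi>0 \<open>even n\<close> by auto

  obtain \<pi>\<^sub>1 S\<^sub>1 where 1: "\<pi>\<^sub>1 permutes {1..n}" "S\<^sub>1 \<subseteq> even_X_words n"
    "\<And>x. x \<in> even_words n \<Longrightarrow> \<phi> x = twist n \<pi>\<^sub>1 S\<^sub>1 x"
    using folded_isometry_is_twist[OF n \<phi>_cube \<phi>0 dist antipodal] E EE by blast

  (* Translations by a and b carry the odd words to the even ones and make f fix the zero word. *)
  define f where "f x = b + \<phi> (x + a)" for x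
  have f_add: "f x + f y = \<phi> (x + a) + \<phi> (y + a)" and shift: "(x + a) + (y + a) = x + y" for x y
    by (simp_all add: f_def ac_simps)
  have "\<exists>\<pi> S. \<pi> permutes {1..n} \<and> S \<subseteq> even_X_words n \<and> (\<forall>x\<in>even_words n. f x = twist n \<pi> S x)"
  proof (rule folded_isometry_is_twist[OF n])
    show "f x \<in> cube n" if "x \<in> even_words n" for x
      using E[OF that] a b \<phi>_cube by (auto simp: f_def)
    show "f 0 \<in> {0, ones n}"
      by (simp add: f_def b_def)
    fix x y assume xy: "x \<in> even_words n" "y \<in> even_words n"
    then have in_cube: "x + a \<in> cube n" "y + a \<in> cube n"
      using E a by auto
    show "weight (f x + f y) \<in> {weight (x + y), n - weight (x + y)}"
      using dist[OF in_cube] EE[OF xy] unfolding f_add shift .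
    show "weight (f x + f y) = n" if "weight (x + y) = n"
      using antipodal[OF in_cube] that unfolding f_add shift .
  qed
  then obtain \<pi>\<^sub>2 S\<^sub>2 where 2: "\<pi>\<^sub>2 permutes {1..n}" "S\<^sub>2 \<subseteq> even_X_words n"
    "\<And>x. x \<in> even_words n \<Longrightarrow> f x = twist n \<pi>\<^sub>2 S\<^sub>2 x"
    by blast

  have "\<phi> c = formula_map n \<pi>\<^sub>1 \<pi>\<^sub>2 S\<^sub>1 S\<^sub>2 a b c" if c: "c \<in> cube n" for c
  proof (cases "c \<in> even_words n")
    case True
    then show ?thesis
      using 1(3) by (simp add: formula_map_eq_twist)
  next
    case False
    then have "c + a \<in> even_words n"
      using c a even_weight_add[OF c a(1)] by (auto simp: even_words_def)
    then have "b + twist n \<pi>\<^sub>2 S\<^sub>2 (c + a) = b + f (c + a)"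
      using 2(3) by simp
    also have "\<dots> = \<phi> c"
      by (simp add: f_def add.assoc)
    finally show ?thesis
      using False by (simp add: formula_map_eq_twist)
  qed
  moreover have "a \<in> odd_words n" "b \<in> odd_words n"
    using a b b_odd by (auto simp: odd_words_def)
  ultimately show ?thesis
    using 1(1,2) 2(1,2) by blast
qed

lemma formula_map_is_isometry:
  assumes n: "4 dvd n" "n > 0"
    and \<pi>\<^sub>1: "\<pi>\<^sub>1 permutes {1..n}" and \<pi>\<^sub>2: "\<pi>\<^sub>2 permutes {1..n}"
    and a: "a \<in> odd_words n" and b: "b \<in> odd_words n"
  shows "cube_isometry n {n div 2, n} (formula_map n \<pi>\<^sub>1 \<pi>\<^sub>2 S\<^sub>1 S\<^sub>2 a b)"
    and "formula_map n \<pi>\<^sub>1 \<pi>\<^sub>2 S\<^sub>1 S\<^sub>2 a b ` {0, ones n} = {0, ones n}"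
proof -
  let ?F = "formula_map n \<pi>\<^sub>1 \<pi>\<^sub>2 S\<^sub>1 S\<^sub>2 a b"
  have n2: "even n" "even (n div 2)"
    using n(1) by (auto elim!: dvdE)
  have a': "a \<in> cube n" "odd (weight a)" and b': "b \<in> cube n" "odd (weight b)"
    using a b by (auto simp: odd_words_def)
  have F_even: "?F x = twist n \<pi>\<^sub>1 S\<^sub>1 x" if "x \<in> cube n" "even (weight x)" for x
    using that by (simp add: formula_map_eq_twist even_words_def)
  have F_odd: "?F x = b + twist n \<pi>\<^sub>2 S\<^sub>2 (x + a)" if "x \<in> cube n" "odd (weight x)" for x
    using that by (simp add: formula_map_eq_twist even_words_def)
  have F_cube: "?F x \<in> cube n" if "x \<in> cube n" for x
    using that F_even[OF that] F_odd[OF that] twist_in_cube[OF \<pi>\<^sub>1] twist_in_cube[OF \<pi>\<^sub>2] a' b'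
    by (cases "even (weight x)") auto
  have F_parity: "even (weight (?F x)) \<longleftrightarrow> even (weight x)" if x: "x \<in> cube n" for x
  proof (cases "even (weight x)")
    case True
    then show ?thesis
      using F_even[OF x] even_weight_twist[OF n2(1) \<pi>\<^sub>1 x] by simp
  next
    case False
    have xa: "x + a \<in> cube n" "even (weight (x + a))"
      using x a' False even_weight_add[OF x a'(1)] by auto
    have "even (weight (twist n \<pi>\<^sub>2 S\<^sub>2 (x + a)))"
      using even_weight_twist[OF n2(1) \<pi>\<^sub>2 xa(1)] xa(2) by simp
    then show ?thesis
      using F_odd[OF x False] even_weight_add[OF b'(1) twist_in_cube[OF \<pi>\<^sub>2 xa(1)]] b' False by simp
  qed
  (* Within a parity class the translations by a and b cancel in differences of words. *)
  have F_class: "\<exists>\<pi> S s. \<pi> permutes {1..n} \<and> s \<in> cube n \<and> ?F x + ?F y = twist n \<pi> S (x + s) + twist n \<pi> S (y + s)"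
    if x: "x \<in> cube n" and y: "y \<in> cube n" and xy: "even (weight x) \<longleftrightarrow> even (weight y)" for x y
  proof (cases "even (weight x)")
    case True
    then show ?thesis
      using F_even[OF x] F_even[OF y] xy \<pi>\<^sub>1 zero_in_cube by (metis add_0_right)
  next
    case False
    then have "?F x + ?F y = twist n \<pi>\<^sub>2 S\<^sub>2 (x + a) + twist n \<pi>\<^sub>2 S\<^sub>2 (y + a)"
      using F_odd[OF x] F_odd[OF y] xy by (simp add: ac_simps)
    then show ?thesis
      using \<pi>\<^sub>2 a' by blast
  qed
  have shift: "(x + s) + (y + s) = x + y" for x y s :: word
    by (simp add: ac_simps)
  have "inj_on ?F (cube n)"
  proof (rule inj_onI)
    fix x y assume x: "x \<in> cube n" and y: "y \<in> cube n" and eq: "?F x = ?F y"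
    have "even (weight x) \<longleftrightarrow> even (weight y)"
      using F_parity[OF x] F_parity[OF y] eq by simp
    then obtain \<pi> S s where \<pi>: "\<pi> permutes {1..n}" and s: "s \<in> cube n"
      and "?F x + ?F y = twist n \<pi> S (x + s) + twist n \<pi> S (y + s)"
      using F_class[OF x y] by blast
    then have "twist n \<pi> S (x + s) = twist n \<pi> S (y + s)"
      using eq by (metis word_add_eq_0_iff)
    then have "x + s = y + s"
      using twist_inj[OF \<pi> n(2)] x y s by blast
    then show "x = y" by simp
  qed
  moreover have "?F ` cube n \<subseteq> cube n"
    using F_cube by blast
  ultimately have bij: "bij_betw ?F (cube n) (cube n)"
    by (simp add: bij_betw_def endo_inj_surj finite_cube)
  have pres: "weight (?F x + ?F y) = p"
    if x: "x \<in> cube n" and y: "y \<in> cube n" and xy: "weight (x + y) = p" and p: "p \<in> {n div 2, n}" for x y p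
  proof -
    have "even (weight (x + y))"
      using xy p n2 by auto
    then have "even (weight x) \<longleftrightarrow> even (weight y)"
      using even_weight_add[OF x y] by simp
    then obtain \<pi> S s where \<pi>: "\<pi> permutes {1..n}" and s: "s \<in> cube n"
      and F: "?F x + ?F y = twist n \<pi> S (x + s) + twist n \<pi> S (y + s)"
      using F_class[OF x y] by blast
    have cube: "x + s \<in> cube n" "y + s \<in> cube n"
      using x y s by auto
    show ?thesis
    proof (cases "p = n")
      case True
      then show ?thesis
        using weight_twist_eq_n[OF \<pi> cube, of S] xy unfolding F shift by simp
    next
      case False
      with p have "p = n div 2" "n - p = n div 2"
        using n2 by (auto elim!: evenE)
      then show ?thesis
        using weight_twist_add_twist[OF \<pi> cube, of S] xy unfolding F shift by auto
    qed
  qed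
  show "cube_isometry n {n div 2, n} ?F"
    unfolding cube_isometry_def hamming_dist_eq_weight using bij pres by blast
  have F0: "?F 0 = twist n \<pi>\<^sub>1 S\<^sub>1 0" and F1: "?F (ones n) = twist n \<pi>\<^sub>1 S\<^sub>1 0 + ones n"
    using F_even[of 0] F_even[of "ones n"] n2 twist_add_ones[OF \<pi>\<^sub>1, of S\<^sub>1 0] by simp_all
  have "twist n \<pi>\<^sub>1 S\<^sub>1 0 \<in> {0, ones n}"
    by (auto simp: twist_def perm_word_def fun_eq_iff)
  then show "?F ` {0, ones n} = {0, ones n}"
    using F0 F1 by auto
qed

theorem theorem5:
  fixes n :: nat
  assumes "n > 0" and "4 dvd n"
  shows
    "(\<forall>\<phi>. cube_isometry n {n div 2, n} \<phi> \<and> \<phi> ` {0, ones n} = {0, ones n} \<longrightarrow>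
        (\<exists>\<pi>\<^sub>1 \<pi>\<^sub>2 S\<^sub>1 S\<^sub>2 a b.
           \<pi>\<^sub>1 permutes {1..n} \<and> \<pi>\<^sub>2 permutes {1..n} \<and>
           S\<^sub>1 \<subseteq> even_X_words n \<and> S\<^sub>2 \<subseteq> even_X_words n \<and>
           a \<in> odd_words n \<and> b \<in> odd_words n \<and>
           (\<forall>c\<in>cube n. \<phi> c = formula_map n \<pi>\<^sub>1 \<pi>\<^sub>2 S\<^sub>1 S\<^sub>2 a b c))) \<and>
     (\<forall>\<pi>\<^sub>1 \<pi>\<^sub>2 S\<^sub>1 S\<^sub>2 a b.
        \<pi>\<^sub>1 permutes {1..n} \<and> \<pi>\<^sub>2 permutes {1..n} \<and>
        S\<^sub>1 \<subseteq> even_X_words n \<and> S\<^sub>2 \<subseteq> even_X_words n \<and>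
        a \<in> odd_words n \<and> b \<in> odd_words n \<longrightarrow>
        cube_isometry n {n div 2, n} (formula_map n \<pi>\<^sub>1 \<pi>\<^sub>2 S\<^sub>1 S\<^sub>2 a b) \<and>
        formula_map n \<pi>\<^sub>1 \<pi>\<^sub>2 S\<^sub>1 S\<^sub>2 a b ` {0, ones n} = {0, ones n})"
  using isometry_is_formula_map[OF assms(2,1)] formula_map_is_isometry[OF assms(2,1)]
  by (intro conjI allI impI) (elim conjE; simp)+

end
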